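(* Let $F:\mathbb{R}^d\to\mathbb{R}$ be $L$-smooth with a global minimizer $x^*$. Let $x_0\in\mathbb{R}^d$, $h>0$, $K\ge1$, and let $$x_{k+1}=x_k-hg_k,\qquad k=0,\dots,K-1,$$ where $(g_k)_{k=0}^{K-1}$ is a MARINA estimator of the gradient along $(x_k)$ with parameters $0<p\le1$ and $\alpha,\theta\ge0$. For $t\in[0,Kh]$ let $x(t)$ be the piecewise linear interpolation of the iterates, $x(t)=x_k-(t-kh)g_k$ for $t\in[kh,(k+1)h]$. If $$0<h\le\frac{1}{10L}\sqrt{\frac{p}{1+\alpha}},$$ then $$\frac{1}{Kh}\int_0^{Kh}\mathbb{E}\left[\|\nabla F(x(t))\|^2\right]dt\le\frac{2\left(\Psi_1-F(x^* )\right)}{Kh}+2C\theta,$$ where $\Psi_1=F(x_0)+hC\,\mathbf G_0$, $\mathbf G_0=\mathbb{E}\left[\|g_0-\nabla F(x_0)\|^2\right]$ and $$C=\frac{8L^2h^2+2}{1-(1-p)(4L^2h^2\alpha+1)}.$$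
   Context: $F$ is $L$-smooth ($L>0$): $F$ is differentiable and $\|\nabla F(x)-\nabla F(y)\|\le L\|x-y\|$ for all $x,y$. $F$ need not be convex. The starting point $x_0$ is deterministic; the $g_k$ are random. MARINA estimator: given a random sequence $(x_k)_k$ in $\mathbb{R}^d$ produced by an algorithm, a random sequence $(g_k)_k$ in $\mathbb{R}^d$ is a MARINA estimator of the gradient with parameters $0<p\le1$, $\alpha,\theta\ge0$ if $\mathbb{E}[g_k]=\mathbb{E}[\nabla F(x_k)]$ for all $k$ and, with $\mathbf G_k=\mathbb{E}\left[\|g_k-\nabla F(x_k)\|^2\right]$, $$\mathbf G_{k+1}\le(1-p)\mathbf G_k+(1-p)L^2\alpha\,\mathbb{E}\left[\|x_{k+1}-x_k\|^2\right]+\theta$$ for all indices $k$ for which $g_k$ and $g_{k+1}$ are both defined. *)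

theory Defs
  imports "HOL-Probability.Probability"
begin

definition grad :: "('a::euclidean_space \<Rightarrow> real) \<Rightarrow> 'a \<Rightarrow> 'a" where
  "grad F x = (THE D. GDERIV F x :> D)"

lemma grad_eqI:
  assumes "GDERIV F x :> D"
  shows "grad F x = D"
  unfolding grad_def
proof (rule the_equality, rule assms)
  fix E assume "GDERIV F x :> E"
  then have "(\<lambda>h. h \<bullet> E) = (\<lambda>h. h \<bullet> D)"
    using assms unfolding gderiv_def by (rule has_derivative_unique)
  then have "h \<bullet> E = h \<bullet> D" for h by (rule fun_cong)
  then show "E = D" by (simp add: euclidean_eq_iff[of E D] inner_commute)
qed

lemma GDERIV_grad:
  fixes F :: "'a::euclidean_space \<Rightarrow> real"
  assumes "F differentiable (at x)"
  shows "GDERIV F x :> grad F x"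
proof -
  obtain f' where f': "(F has_derivative f') (at x)"
    using assms unfolding differentiable_def by blast
  then interpret linear f' by (rule has_derivative_linear)
  have "f' = (\<lambda>h. h \<bullet> adjoint f' 1)"
    using adjoint_works[OF linear_axioms, of _ 1] by (simp add: fun_eq_iff)
  then have "GDERIV F x :> adjoint f' 1"
    using f' unfolding gderiv_def by (rule back_subst[where P = "\<lambda>u. (F has_derivative u) (at x)", rotated])
  then show ?thesis by (simp add: grad_eqI)
qed

definition L_smooth :: "real \<Rightarrow> ('a::euclidean_space \<Rightarrow> real) \<Rightarrow> bool" where
  "L_smooth L F \<longleftrightarrow> L > 0 \<and> (\<forall>x. F differentiable (at x)) \<and>
     (\<forall>x y. norm (grad F x - grad F y) \<le> L * norm (x - y))"

text \<open>The expectation of a squared norm is taken in the extended nonnegative reals, so that it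
  is meaningful (possibly infinite) without any square-integrability assumption; a Bochner
  integral would silently be 0 when the squared norm is not integrable.\<close>

definition E_norm2 :: "'w measure \<Rightarrow> ('w \<Rightarrow> 'a::real_normed_vector) \<Rightarrow> ennreal" where
  "E_norm2 M Y = (\<integral>\<^sup>+\<omega>. ennreal ((norm (Y \<omega>))\<^sup>2) \<partial>M)"

definition grad_mse ::
  "'w measure \<Rightarrow> ('a::euclidean_space \<Rightarrow> real) \<Rightarrow> (nat \<Rightarrow> 'w \<Rightarrow> 'a) \<Rightarrow> (nat \<Rightarrow> 'w \<Rightarrow> 'a) \<Rightarrow> nat \<Rightarrow> ennreal"
  where "grad_mse M F x g k = E_norm2 M (\<lambda>\<omega>. g k \<omega> - grad F (x k \<omega>))"

text \<open>The estimator is the finite family \<open>g 0, \<dots>, g (K - 1)\<close>; other values of \<open>g\<close> are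
  irrelevant. Integrability of \<open>g k\<close> and of \<open>grad F (x k)\<close> says that the two expectations in
  the unbiasedness condition exist.\<close>

definition marina_estimator ::
  "'w measure \<Rightarrow> ('a::euclidean_space \<Rightarrow> real) \<Rightarrow> real \<Rightarrow> real \<Rightarrow> real \<Rightarrow> real \<Rightarrow> nat \<Rightarrow>
    (nat \<Rightarrow> 'w \<Rightarrow> 'a) \<Rightarrow> (nat \<Rightarrow> 'w \<Rightarrow> 'a) \<Rightarrow> bool"
  where
  "marina_estimator M F L p \<alpha> \<theta> K x g \<longleftrightarrow>
     0 < p \<and> p \<le> 1 \<and> 0 \<le> \<alpha> \<and> 0 \<le> \<theta> \<and>
     (\<forall>k<K. x k \<in> borel_measurable M \<and> g k \<in> borel_measurable M) \<and>
     (\<forall>k<K. integrable M (g k) \<and> integrable M (\<lambda>\<omega>. grad F (x k \<omega>)) \<and>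
        (\<integral>\<omega>. g k \<omega> \<partial>M) = (\<integral>\<omega>. grad F (x k \<omega>) \<partial>M)) \<and>
     (\<forall>k. Suc k < K \<longrightarrow>
        grad_mse M F x g (Suc k)
          \<le> ennreal (1 - p) * grad_mse M F x g k
            + ennreal ((1 - p) * L\<^sup>2 * \<alpha>) * E_norm2 M (\<lambda>\<omega>. x (Suc k) \<omega> - x k \<omega>)
            + ennreal \<theta>)"

end

(* Along a step, d/dt F(x(t)) = - <grad F(x(t)), g_k>
   = - |grad F(x(t))|^2 / 2 - |g_k|^2 / 2 + |grad F(x(t)) - g_k|^2 / 2, and smoothness absorbs part
   of the last term into |g_k|^2, leaving the error |g_k - grad F(x_k)|^2. Integrating over a step,
   telescoping and taking expectations bounds the integral of E |grad F(x(t))|^2 plus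
   h/2 sum E |g_k|^2 by 2 (F(x_0) - F(x_star)) + 2 h sum G_k. Summing the MARINA recursion bounds
   p sum G_k by G_0 + K theta plus a multiple of sum E |g_k|^2 which, by the step size condition,
   is small enough to be absorbed; finally 1 / p <= C. *)
theory Submission
  imports Defs
begin

section \<open>Displacements, continuity of the gradient and derivatives along a step\<close>

text \<open>Turns the displacement term of the MARINA recursion into the second moment of the
  estimator, which is the quantity controlled by the descent inequality.\<close>

lemma E_norm2_step:
  assumes "\<forall>\<omega>\<in>space M. x' \<omega> = x \<omega> - h *\<^sub>R v \<omega>" and "v \<in> borel_measurable M"
  shows "E_norm2 M (\<lambda>\<omega>. x' \<omega> - x \<omega>) = ennreal (h\<^sup>2) * E_norm2 M v"
proof -
  have "E_norm2 M (\<lambda>\<omega>. x' \<omega> - x \<omega>) = (\<integral>\<^sup>+\<omega>. ennreal (h\<^sup>2) * ennreal ((norm (v \<omega>))\<^sup>2) \<partial>M)"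
    unfolding E_norm2_def using assms(1)
    by (intro nn_integral_cong) (simp add: power_mult_distrib flip: ennreal_mult)
  then show ?thesis
    using assms(2) by (simp add: E_norm2_def nn_integral_cmult)
qed

lemma L_smooth_continuous_grad:
  assumes "L_smooth L F"
  shows "continuous_on UNIV (grad F)"
proof -
  have "L-lipschitz_on UNIV (grad F)"
    using assms by (intro lipschitz_onI) (auto simp: L_smooth_def dist_norm)
  then show ?thesis
    by (rule lipschitz_on_continuous_on)
qed

lemma L_smooth_borel_measurable_grad:
  assumes "L_smooth L F"
  shows "grad F \<in> borel_measurable borel"
  using L_smooth_continuous_grad[OF assms] by (rule borel_measurable_continuous_onI)

text \<open>Chain rule in the time variable. The start time \<open>a\<close> is kept as a parameter
  so that the formula applies to every step of the interpolated path.\<close>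

lemma L_smooth_DERIV_along_line:
  assumes "L_smooth L F"
  shows "((\<lambda>s. F (x - (s - a) *\<^sub>R v)) has_real_derivative
           - (grad F (x - (s - a) *\<^sub>R v) \<bullet> v)) (at s)"
proof -
  have "GDERIV F (x - (s - a) *\<^sub>R v) :> grad F (x - (s - a) *\<^sub>R v)"
    using assms by (intro GDERIV_grad) (auto simp: L_smooth_def)
  then have F: "(F has_derivative (\<lambda>u. u \<bullet> grad F (x - (s - a) *\<^sub>R v)))
      (at (x - (s - a) *\<^sub>R v))"
    by (simp add: gderiv_def)
  have "((\<lambda>s. x - (s - a) *\<^sub>R v) has_derivative (\<lambda>u. - (u *\<^sub>R v))) (at s)"
    by (auto intro!: derivative_eq_intros)
  from has_derivative_compose[OF this F] show ?thesis
    unfolding has_field_derivative_def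
    by (rule back_subst[where P = "\<lambda>u. (_ has_derivative u) _"])
       (auto simp: inner_commute)
qed

section \<open>Pathwise descent over one step\<close>

text \<open>Expand |u|^2 = 2 <u, v> - |v|^2 + |u - v|^2 and split u - v through
  \<open>grad F x\<close>. Smoothness bounds |u - grad F x| by L s |v|, hence by |v| / 2, so |u -
  v|^2 costs at most |v|^2 / 2 plus twice the squared error. The surviving -|v|^2 / 2 later absorbs
  the displacement terms.\<close>

lemma norm_grad_along_line_le:
  fixes F :: "'a::euclidean_space \<Rightarrow> real"
  assumes F: "L_smooth L F" and s: "0 \<le> s" "L * s \<le> 1 / 2"
    and u_def: "u = grad F (x - s *\<^sub>R v)"
  shows "(norm u)\<^sup>2 \<le> 2 * (u \<bullet> v) - (norm v)\<^sup>2 / 2 + 2 * (norm (v - grad F x))\<^sup>2"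
proof -
  have "norm (u - grad F x) \<le> L * norm ((x - s *\<^sub>R v) - x)"
    using F unfolding L_smooth_def u_def by blast
  also have "\<dots> = L * s * norm v"
    using s by simp
  also have "\<dots> \<le> 1 / 2 * norm v"
    using mult_right_mono[OF s(2) norm_ge_zero[of v]] .
  finally have "(norm (u - grad F x))\<^sup>2 \<le> (1 / 2 * norm v)\<^sup>2"
    by (rule power_mono) simp
  moreover have "(norm (u - v))\<^sup>2 \<le> 2 * (norm (u - grad F x))\<^sup>2 + 2 * (norm (v - grad F x))\<^sup>2"
  proof -
    have "norm (u - v) \<le> norm (u - grad F x) + norm (v - grad F x)"
      using norm_triangle_ineq4[of "u - grad F x" "v - grad F x"] by simp
    then have "(norm (u - v))\<^sup>2 \<le> (norm (u - grad F x) + norm (v - grad F x))\<^sup>2"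
      by (rule power_mono) simp
    also have "\<dots> \<le> 2 * (norm (u - grad F x))\<^sup>2 + 2 * (norm (v - grad F x))\<^sup>2"
      using sum_squares_bound[of "norm (u - grad F x)" "norm (v - grad F x)"]
      by (simp add: power2_sum)
    finally show ?thesis .
  qed
  moreover have "(norm (u - v))\<^sup>2 = (norm u)\<^sup>2 - 2 * (u \<bullet> v) + (norm v)\<^sup>2"
    by (simp add: power2_norm_eq_inner inner_diff inner_commute algebra_simps)
  ultimately show ?thesis
    by (simp add: power_mult_distrib power_divide)
qed

text \<open>The pointwise bound on the squared gradient has an explicit antiderivative, because the
  inner product with \<open>v\<close> is minus the derivative of F along the step. Subtracting the
  lower bound \<open>m\<close> keeps the function values nonnegative, so that \<open>ennreal\<close>
  does not truncate them.\<close>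

lemma descent_step:
  fixes F :: "'a::euclidean_space \<Rightarrow> real"
  assumes F: "L_smooth L F" and h: "0 \<le> h" "L * h \<le> 1 / 2" and m: "\<forall>y. m \<le> F y"
  shows "(\<integral>\<^sup>+s\<in>{a..a + h}. ennreal ((norm (grad F (x - (s - a) *\<^sub>R v)))\<^sup>2) \<partial>lborel)
      + ennreal (2 * (F (x - h *\<^sub>R v) - m)) + ennreal (h / 2) * ennreal ((norm v)\<^sup>2)
    \<le> ennreal (2 * (F x - m)) + ennreal (2 * h) * ennreal ((norm (v - grad F x))\<^sup>2)"
proof -
  define e where "e = (norm (v - grad F x))\<^sup>2"
  \<comment> \<open>\<open>f\<close> is the right-hand side of
    \<open>norm_grad_along_line_le\<close> along the path, and \<open>\<Phi>\<close> is its
    antiderivative.\<close>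
  define f where "f s = 2 * (grad F (x - (s - a) *\<^sub>R v) \<bullet> v) - (norm v)\<^sup>2 / 2 + 2 * e" for s
  define \<Phi> where
    "\<Phi> s = - 2 * F (x - (s - a) *\<^sub>R v) - (s - a) * (norm v)\<^sup>2 / 2 + 2 * (s - a) * e" for s
  have \<Phi>: "(\<Phi> has_real_derivative f s) (at s)" for s
    unfolding \<Phi>_def f_def
    by (auto intro!: derivative_eq_intros L_smooth_DERIV_along_line[OF F])
  have le_f: "(norm (grad F (x - (s - a) *\<^sub>R v)))\<^sup>2 \<le> f s" if "s \<in> {a..a + h}" for s
  proof -
    have "L * (s - a) \<le> L * h"
      using that F by (intro mult_left_mono) (auto simp: L_smooth_def)
    then show ?thesis
      using that h norm_grad_along_line_le[OF F _ _ refl, where s = "s - a" and x = x and v = v] by (simp add: f_def e_def)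
  qed
  \<comment> \<open>On the step, \<open>f\<close> dominates a square. Its sign is needed twice: for
    the fundamental theorem with a nonnegative integral, and for the monotonicity of
    \<open>\<Phi>\<close>.\<close>
  have f0: "0 \<le> f s" if "a \<le> s" "s \<le> a + h" for s
    using le_f[of s] that by (smt (verit) atLeastAtMost_iff zero_le_power2)
  have f_meas: "f \<in> borel_measurable borel"
    unfolding f_def
    by (intro borel_measurable_continuous_onI continuous_intros
        continuous_on_compose2[OF L_smooth_continuous_grad[OF F]]) auto
  have mono: "\<Phi> a \<le> \<Phi> (a + h)"
  proof (rule DERIV_nonneg_imp_nondecreasing[where f = \<Phi>])
    show "a \<le> a + h"
      using h(1) by simp
  qed (metis \<Phi> f0)
  have "(\<integral>\<^sup>+s\<in>{a..a + h}. ennreal ((norm (grad F (x - (s - a) *\<^sub>R v)))\<^sup>2) \<partial>lborel)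
      \<le> (\<integral>\<^sup>+s\<in>{a..a + h}. ennreal (f s) \<partial>lborel)"
    by (intro nn_integral_mono) (auto simp: indicator_def le_f intro!: ennreal_leI)
  also have "\<dots> = ennreal (\<Phi> (a + h) - \<Phi> a)"
    using h f0 by (intro nn_integral_FTC_Icc f_meas) (auto intro: \<Phi> has_field_derivative_at_within)
  finally have "(\<integral>\<^sup>+s\<in>{a..a + h}. ennreal ((norm (grad F (x - (s - a) *\<^sub>R v)))\<^sup>2) \<partial>lborel)
      + ennreal (2 * (F (x - h *\<^sub>R v) - m)) + ennreal (h / 2) * ennreal ((norm v)\<^sup>2)
    \<le> ennreal (\<Phi> (a + h) - \<Phi> a)
      + ennreal (2 * (F (x - h *\<^sub>R v) - m)) + ennreal (h / 2) * ennreal ((norm v)\<^sup>2)"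
    by (intro add_right_mono)
  \<comment> \<open>All three summands are nonnegative, the first by \<open>mono\<close>, so they
    merge into one real number, in which the end value of F and the |v|^2 terms cancel.\<close>
  also have "\<dots> = ennreal (\<Phi> (a + h) - \<Phi> a + 2 * (F (x - h *\<^sub>R v) - m) + h / 2 * (norm v)\<^sup>2)"
    using h(1) mono spec[OF m, of "x - h *\<^sub>R v"] by (subst ennreal_mult[symmetric]) auto
  also have "\<Phi> (a + h) - \<Phi> a + 2 * (F (x - h *\<^sub>R v) - m) + h / 2 * (norm v)\<^sup>2
      = 2 * (F x - m) + 2 * h * e"
    by (simp add: \<Phi>_def algebra_simps)
  also have "ennreal \<dots> = ennreal (2 * (F x - m)) + ennreal (2 * h) * ennreal e"
    using h(1) spec[OF m, of x] by (subst ennreal_mult[symmetric]) (auto simp: e_def)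
  finally show ?thesis
    by (simp add: e_def)
qed

section \<open>Descent in expectation and finiteness of the second moments\<close>

text \<open>The one-step inequality is telescoped for each outcome, then integrated over the
  probability space; Tonelli exchanges time and expectation. Working in \<open>ennreal\<close>
  throughout lets both sides be infinite, so the bound can serve to prove finiteness.\<close>

lemma expected_descent:
  fixes F :: "'a::euclidean_space \<Rightarrow> real" and M :: "'w measure"
  assumes "prob_space M" and F: "L_smooth L F"
    and h: "0 \<le> h" "L * h \<le> 1 / 2" and m: "\<forall>y. m \<le> F y"
    and x0: "\<forall>\<omega>\<in>space M. x 0 \<omega> = x\<^sub>0"
    and step: "\<forall>k<K. \<forall>\<omega>\<in>space M. x (Suc k) \<omega> = x k \<omega> - h *\<^sub>R g k \<omega>"
    and meas: "\<And>k. k < K \<Longrightarrow> x k \<in> borel_measurable M" "\<And>k. k < K \<Longrightarrow> g k \<in> borel_measurable M"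
  shows "(\<Sum>k<K. \<integral>\<^sup>+t\<in>{real k * h..real (Suc k) * h}.
            E_norm2 M (\<lambda>\<omega>. grad F (x k \<omega> - (t - real k * h) *\<^sub>R g k \<omega>)) \<partial>lborel)
          + ennreal (h / 2) * (\<Sum>k<K. E_norm2 M (g k))
        \<le> ennreal (2 * (F x\<^sub>0 - m)) + ennreal (2 * h) * (\<Sum>k<K. grad_mse M F x g k)"
proof -
  interpret prob_space M by fact
  interpret pair_sigma_finite lborel M ..
  note L_smooth_borel_measurable_grad[OF F, measurable]
  \<comment> \<open>The time window is built into \<open>u\<close> as an indicator, which makes each
    piece a single jointly measurable function to which Tonelli applies.\<close>
  define u where "u k t \<omega> = ennreal ((norm (grad F (x k \<omega> - (t - real k * h) *\<^sub>R g k \<omega>)))\<^sup>2)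
    * indicator {real k * h..real (Suc k) * h} t" for k t \<omega>
  define I where "I k \<omega> = (\<integral>\<^sup>+t. u k t \<omega> \<partial>lborel)" for k \<omega>
  have u_meas: "case_prod (u k) \<in> borel_measurable (lborel \<Otimes>\<^sub>M M)"
    "case_prod (\<lambda>\<omega> t. u k t \<omega>) \<in> borel_measurable (M \<Otimes>\<^sub>M lborel)" if "k < K" for k
    using meas[OF that, measurable] unfolding u_def by measurable
  have I_meas: "I k \<in> borel_measurable M" if "k < K" for k
    unfolding I_def using u_meas(2)[OF that] by (rule lborel.borel_measurable_nn_integral)
  have I_eq: "(\<integral>\<^sup>+t\<in>{real k * h..real (Suc k) * h}.
      E_norm2 M (\<lambda>\<omega>. grad F (x k \<omega> - (t - real k * h) *\<^sub>R g k \<omega>)) \<partial>lborel)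
      = (\<integral>\<^sup>+\<omega>. I k \<omega> \<partial>M)" if "k < K" for k
  proof -
    note meas[OF that, measurable]
    have "(\<integral>\<^sup>+t\<in>{real k * h..real (Suc k) * h}.
        E_norm2 M (\<lambda>\<omega>. grad F (x k \<omega> - (t - real k * h) *\<^sub>R g k \<omega>)) \<partial>lborel)
        = (\<integral>\<^sup>+t. (\<integral>\<^sup>+\<omega>. u k t \<omega> \<partial>M) \<partial>lborel)"
      unfolding E_norm2_def u_def by (subst nn_integral_multc) auto
    then show ?thesis
      unfolding I_def by (simp add: Fubini'[OF u_meas(1)[OF that]])
  qed
  have pathwise: "(\<Sum>k<n. I k \<omega>) + ennreal (2 * (F (x n \<omega>) - m))
      + ennreal (h / 2) * (\<Sum>k<n. ennreal ((norm (g k \<omega>))\<^sup>2))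
    \<le> ennreal (2 * (F x\<^sub>0 - m))
      + ennreal (2 * h) * (\<Sum>k<n. ennreal ((norm (g k \<omega> - grad F (x k \<omega>)))\<^sup>2))"
    if \<omega>: "\<omega> \<in> space M" and "n \<le> K" for n \<omega>
    using \<open>n \<le> K\<close>
  proof (induction n)
    case 0
    then show ?case using x0 \<omega> by simp
  next
    case (Suc n)
    have "I n \<omega> + ennreal (2 * (F (x (Suc n) \<omega>) - m))
        + ennreal (h / 2) * ennreal ((norm (g n \<omega>))\<^sup>2)
      \<le> ennreal (2 * (F (x n \<omega>) - m))
        + ennreal (2 * h) * ennreal ((norm (g n \<omega> - grad F (x n \<omega>)))\<^sup>2)"
      using descent_step[OF F h m, where a = "real n * h" and x = "x n \<omega>" and v = "g n \<omega>"] step \<omega> Suc.prems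
      by (simp add: I_def u_def add.commute distrib_right)
    moreover have "(\<Sum>k<n. I k \<omega>) + ennreal (2 * (F (x n \<omega>) - m))
        + ennreal (h / 2) * (\<Sum>k<n. ennreal ((norm (g k \<omega>))\<^sup>2))
      \<le> ennreal (2 * (F x\<^sub>0 - m))
        + ennreal (2 * h) * (\<Sum>k<n. ennreal ((norm (g k \<omega> - grad F (x k \<omega>)))\<^sup>2))"
      using Suc by simp
    ultimately have "(I n \<omega> + ennreal (2 * (F (x (Suc n) \<omega>) - m))
          + ennreal (h / 2) * ennreal ((norm (g n \<omega>))\<^sup>2))
        + ((\<Sum>k<n. I k \<omega>) + ennreal (2 * (F (x n \<omega>) - m))
          + ennreal (h / 2) * (\<Sum>k<n. ennreal ((norm (g k \<omega>))\<^sup>2)))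
      \<le> (ennreal (2 * (F (x n \<omega>) - m))
          + ennreal (2 * h) * ennreal ((norm (g n \<omega> - grad F (x n \<omega>)))\<^sup>2))
        + (ennreal (2 * (F x\<^sub>0 - m))
          + ennreal (2 * h) * (\<Sum>k<n. ennreal ((norm (g k \<omega> - grad F (x k \<omega>)))\<^sup>2)))"
      by (rule add_mono)
    then have "ennreal (2 * (F (x n \<omega>) - m))
        + ((\<Sum>k<Suc n. I k \<omega>) + ennreal (2 * (F (x (Suc n) \<omega>) - m))
          + ennreal (h / 2) * (\<Sum>k<Suc n. ennreal ((norm (g k \<omega>))\<^sup>2)))
      \<le> ennreal (2 * (F (x n \<omega>) - m))
        + (ennreal (2 * (F x\<^sub>0 - m))
          + ennreal (2 * h) * (\<Sum>k<Suc n. ennreal ((norm (g k \<omega> - grad F (x k \<omega>)))\<^sup>2)))"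
      unfolding sum.lessThan_Suc distrib_left by (simp only: ac_simps)
    \<comment> \<open>Telescoping without subtraction: the intermediate gap stands on both sides and
      may be cancelled because it is an embedded real, hence finite.\<close>
    then show ?case
      by (simp only: ennreal_add_left_cancel_le) simp
  qed
  have "(\<integral>\<^sup>+\<omega>. (\<Sum>k<K. I k \<omega>)
      + ennreal (h / 2) * (\<Sum>k<K. ennreal ((norm (g k \<omega>))\<^sup>2)) \<partial>M)
    \<le> (\<integral>\<^sup>+\<omega>. ennreal (2 * (F x\<^sub>0 - m))
      + ennreal (2 * h) * (\<Sum>k<K. ennreal ((norm (g k \<omega> - grad F (x k \<omega>)))\<^sup>2)) \<partial>M)"
  proof (rule nn_integral_mono)
    fix \<omega> assume "\<omega> \<in> space M"
    \<comment> \<open>The nonnegative final gap is dropped before integrating, since measurability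
      is at hand only for \<open>x k\<close> with k < K.\<close>
    have "(\<Sum>k<K. I k \<omega>) + ennreal (h / 2) * (\<Sum>k<K. ennreal ((norm (g k \<omega>))\<^sup>2))
      \<le> (\<Sum>k<K. I k \<omega>) + ennreal (2 * (F (x K \<omega>) - m))
        + ennreal (h / 2) * (\<Sum>k<K. ennreal ((norm (g k \<omega>))\<^sup>2))"
      by (intro add_right_mono) simp
    also note pathwise[OF \<open>\<omega> \<in> space M\<close> order_refl]
    finally show "(\<Sum>k<K. I k \<omega>) + ennreal (h / 2) * (\<Sum>k<K. ennreal ((norm (g k \<omega>))\<^sup>2))
      \<le> ennreal (2 * (F x\<^sub>0 - m))
      + ennreal (2 * h) * (\<Sum>k<K. ennreal ((norm (g k \<omega> - grad F (x k \<omega>)))\<^sup>2))" .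
  qed
  moreover have m1: "(\<lambda>\<omega>. ennreal ((norm (g k \<omega>))\<^sup>2)) \<in> borel_measurable M"
    and m2: "(\<lambda>\<omega>. ennreal ((norm (g k \<omega> - grad F (x k \<omega>)))\<^sup>2)) \<in> borel_measurable M"
    if "k < K" for k
    using meas[OF that, measurable] by measurable
  moreover have "(\<integral>\<^sup>+\<omega>. (\<Sum>k<K. I k \<omega>) \<partial>M) = (\<Sum>k<K. \<integral>\<^sup>+\<omega>. I k \<omega> \<partial>M)"
    "(\<integral>\<^sup>+\<omega>. (\<Sum>k<K. ennreal ((norm (g k \<omega>))\<^sup>2)) \<partial>M) = (\<Sum>k<K. E_norm2 M (g k))"
    "(\<integral>\<^sup>+\<omega>. (\<Sum>k<K. ennreal ((norm (g k \<omega> - grad F (x k \<omega>)))\<^sup>2)) \<partial>M)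
      = (\<Sum>k<K. grad_mse M F x g k)"
    unfolding grad_mse_def E_norm2_def by (intro nn_integral_sum I_meas m1 m2; simp)+
  ultimately have "(\<Sum>k<K. \<integral>\<^sup>+\<omega>. I k \<omega> \<partial>M) + ennreal (h / 2) * (\<Sum>k<K. E_norm2 M (g k))
    \<le> ennreal (2 * (F x\<^sub>0 - m)) + ennreal (2 * h) * (\<Sum>k<K. grad_mse M F x g k)"
    using I_meas
    by (simp add: nn_integral_add nn_integral_cmult borel_measurable_sum emeasure_space_1
        del: sum_ennreal)
  moreover have "(\<Sum>k<K. \<integral>\<^sup>+t\<in>{real k * h..real (Suc k) * h}.
      E_norm2 M (\<lambda>\<omega>. grad F (x k \<omega> - (t - real k * h) *\<^sub>R g k \<omega>)) \<partial>lborel)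
      = (\<Sum>k<K. \<integral>\<^sup>+\<omega>. I k \<omega> \<partial>M)"
    by (intro sum.cong refl I_eq) simp
  ultimately show ?thesis by simp
qed

text \<open>Finiteness propagates along the iterates because \<open>expected_descent\<close> at \<open>Suc k\<close> bounds
  the second moments of \<open>g 0, \<dots>, g k\<close> by the errors \<open>grad_mse M F x g j\<close>, \<open>j \<le> k\<close>.\<close>

lemma marina_finite:
  fixes F :: "'a::euclidean_space \<Rightarrow> real"
  assumes "prob_space M" and F: "L_smooth L F"
    and h: "0 < h" "L * h \<le> 1 / 2" and m: "\<forall>y. m \<le> F y"
    and x0: "\<forall>\<omega>\<in>space M. x 0 \<omega> = x\<^sub>0"
    and step: "\<forall>k<K. \<forall>\<omega>\<in>space M. x (Suc k) \<omega> = x k \<omega> - h *\<^sub>R g k \<omega>"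
    and marina: "marina_estimator M F L p \<alpha> \<theta> K x g"
    and G0: "grad_mse M F x g 0 < \<infinity>" and "k < K"
  shows "grad_mse M F x g k < \<infinity> \<and> E_norm2 M (g k) < \<infinity>"
  using \<open>k < K\<close>
proof (induction k rule: less_induct)
  case (less k)
  have g_finite: "E_norm2 M (g k) < \<infinity>" if "grad_mse M F x g k < \<infinity>"
  proof -
    \<comment> \<open>The horizon is \<open>Suc k\<close> instead of \<open>K\<close>, so only
      errors with index at most k occur on the right, and these are already known to be
      finite.\<close>
    have "ennreal (h / 2) * (\<Sum>j<Suc k. E_norm2 M (g j))
        \<le> ennreal (2 * (F x\<^sub>0 - m)) + ennreal (2 * h) * (\<Sum>j<Suc k. grad_mse M F x g j)"
      using less.prems h step marina unfolding marina_estimator_def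
      by (intro order_trans[OF _ expected_descent[where M = M and F = F and L = L and x = x]]
          assms(1) F m x0) auto
    also have "\<dots> < \<infinity>"
      using less that by (auto simp: ennreal_mult_less_top less_Suc_eq)
    finally have "(\<Sum>j<Suc k. E_norm2 M (g j)) < \<infinity>"
      using h by (auto simp: ennreal_mult_less_top)
    then show ?thesis by simp
  qed
  \<comment> \<open>The error at k comes first: the recursion bounds it by the error and the second
    moment at the preceding index. The second moment at k then follows from
    \<open>g_finite\<close>.\<close>
  have "grad_mse M F x g k < \<infinity>"
  proof (cases k)
    case (Suc j)
    have "E_norm2 M (\<lambda>\<omega>. x (Suc j) \<omega> - x j \<omega>) = ennreal (h\<^sup>2) * E_norm2 M (g j)"
      using less.prems Suc step marina by (intro E_norm2_step) (auto simp: marina_estimator_def)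
    then show ?thesis
      using less Suc marina unfolding marina_estimator_def
      by (auto simp: ennreal_mult_less_top intro: le_less_trans)
  qed (use G0 in simp)
  with g_finite show ?case by blast
qed

section \<open>Summed recursion and constants\<close>

text \<open>The recursion reads p G_k \<le> G_k - G_(k+1) + a T_k + \<theta>, whose right-hand side
  telescopes.\<close>

lemma sum_le_of_contraction:
  fixes G T :: "nat \<Rightarrow> real"
  assumes rec: "\<And>k. Suc k < K \<Longrightarrow> G (Suc k) \<le> (1 - p) * G k + a * T k + \<theta>"
    and nonneg: "p \<le> 1" "0 \<le> a" "0 \<le> \<theta>" "\<And>k. 0 \<le> G k" "\<And>k. 0 \<le> T k"
  shows "p * (\<Sum>k<K. G k) \<le> G 0 + a * (\<Sum>k<K. T k) + real K * \<theta>"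
proof (cases K)
  case 0
  then show ?thesis using nonneg by simp
next
  case (Suc N)
  \<comment> \<open>The extra \<open>(1 - p) * G n\<close> is exactly what the next use of the
    recursion consumes, since G_(n+1) splits into the shares p and 1 - p. Only n recursion steps
    have been used, hence the sum of T stops before n.\<close>
  have "p * (\<Sum>k\<le>n. G k) + (1 - p) * G n \<le> G 0 + a * (\<Sum>k<n. T k) + real n * \<theta>" if "n < K" for n
    using that
  proof (induction n)
    case 0
    then show ?case by (simp add: algebra_simps)
  next
    case (Suc n)
    then show ?case
      using rec[of n] by (simp add: algebra_simps)
  qed
  from this[of N] have "p * (\<Sum>k<K. G k) + (1 - p) * G N \<le> G 0 + a * (\<Sum>k<N. T k) + real N * \<theta>"
    by (simp add: Suc lessThan_Suc_atMost)
  moreover have "0 \<le> (1 - p) * G N" "a * (\<Sum>k<N. T k) \<le> a * (\<Sum>k<K. T k)"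
    "real N * \<theta> \<le> real K * \<theta>"
    using nonneg by (auto simp: Suc intro!: mult_left_mono mult_right_mono)
  ultimately show ?thesis by linarith
qed

text \<open>Squaring the step size condition turns its factor 10 into 100. The first bound makes the
  recursion's displacement terms absorbable; the second, from p / (1 + \<alpha>) \<le> 1, is what
  the pathwise estimate requires.\<close>

lemma step_size_bound:
  assumes "0 < L" "0 < h" "0 < p" "p \<le> 1" "0 \<le> \<alpha>"
    and h: "h \<le> 1 / (10 * L) * sqrt (p / (1 + \<alpha>))"
  shows "100 * (L\<^sup>2 * h\<^sup>2 * (1 + \<alpha>)) \<le> p" and "L * h \<le> 1 / 2"
proof -
  have "10 * (L * h) \<le> sqrt (p / (1 + \<alpha>))"
    using h assms(1) by (simp add: field_simps)
  then have "(10 * (L * h))\<^sup>2 \<le> (sqrt (p / (1 + \<alpha>)))\<^sup>2"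
    using assms by (intro power_mono) auto
  then have *: "100 * (L * h)\<^sup>2 \<le> p / (1 + \<alpha>)"
    using assms by (simp add: power_mult_distrib)
  then show "100 * (L\<^sup>2 * h\<^sup>2 * (1 + \<alpha>)) \<le> p"
    using assms by (simp add: pos_le_divide_eq power_mult_distrib mult.assoc)
  have "p / (1 + \<alpha>) \<le> 1"
    using assms by simp
  with * have "(L * h)\<^sup>2 \<le> (1 / 2)\<^sup>2"
    by (simp add: power_divide)
  then show "L * h \<le> 1 / 2"
    by (rule power2_le_imp_le) simp
qed

text \<open>The denominator of C equals p - d for a d with 0 \<le> d < p, and the numerator is at
  least 1. The step size condition gives d \<le> 4 p / 100, so the denominator is positive.\<close>

lemma marina_constant_ge:
  assumes "0 < p" "p \<le> 1" "0 \<le> \<alpha>" and h: "100 * (L\<^sup>2 * h\<^sup>2 * (1 + \<alpha>)) \<le> (p::real)"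
    and C: "C = (8 * L\<^sup>2 * h\<^sup>2 + 2) / (1 - (1 - p) * (4 * L\<^sup>2 * h\<^sup>2 * \<alpha> + 1))"
  shows "1 / p \<le> C"
proof -
  define d where "d = (1 - p) * (4 * L\<^sup>2 * h\<^sup>2 * \<alpha>)"
  have "0 \<le> d"
    using assms by (simp add: d_def)
  have "0 \<le> L\<^sup>2 * h\<^sup>2" and "0 \<le> L\<^sup>2 * h\<^sup>2 * \<alpha>"
    using assms by simp_all
  then have "100 * (L\<^sup>2 * h\<^sup>2 * \<alpha>) \<le> p"
    using h unfolding distrib_left mult_1_right by linarith
  moreover have "d \<le> 1 * (4 * L\<^sup>2 * h\<^sup>2 * \<alpha>)"
    unfolding d_def using assms by (intro mult_right_mono) auto
  ultimately have "d < p"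
    using \<open>0 < p\<close> \<open>0 \<le> L\<^sup>2 * h\<^sup>2 * \<alpha>\<close> by simp
  have "1 / p \<le> 1 / (p - d)"
    using \<open>0 < p\<close> \<open>0 \<le> d\<close> \<open>d < p\<close> by (intro divide_left_mono) auto
  also have "\<dots> \<le> (8 * L\<^sup>2 * h\<^sup>2 + 2) / (p - d)"
    using \<open>d < p\<close> \<open>0 \<le> L\<^sup>2 * h\<^sup>2\<close> by (intro divide_right_mono) auto
  also have "p - d = 1 - (1 - p) * (4 * L\<^sup>2 * h\<^sup>2 * \<alpha> + 1)"
    by (simp add: d_def algebra_simps)
  finally show ?thesis
    unfolding C .
qed

section \<open>Splitting the time integral at the grid points\<close>

text \<open>The closed pieces cover the whole interval. Grid points counted twice only enlarge the
  right-hand side, so the comparison is pointwise and involves no null sets when K > 0.\<close>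

lemma nn_integral_piecewise_le:
  fixes f :: "real \<Rightarrow> ennreal"
  assumes "0 < h" and meas: "\<And>k. k < K \<Longrightarrow> \<phi> k \<in> borel_measurable borel"
    and eq: "\<And>k t. k < K \<Longrightarrow> t \<in> {real k * h..real (Suc k) * h} \<Longrightarrow> f t = \<phi> k t"
  shows "(\<integral>\<^sup>+t\<in>{0..real K * h}. f t \<partial>lborel)
    \<le> (\<Sum>k<K. \<integral>\<^sup>+t\<in>{real k * h..real (Suc k) * h}. \<phi> k t \<partial>lborel)"
proof (cases "K = 0")
  case False
  have "f t * indicator {0..real K * h} t
      \<le> (\<Sum>k<K. \<phi> k t * indicator {real k * h..real (Suc k) * h} t)" for t
  proof (cases "t \<in> {0..real K * h}")
    case True
    obtain k where k: "k < K" "t \<in> {real k * h..real (Suc k) * h}"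
    \<comment> \<open>The right endpoint belongs to the last piece, with index \<open>K - 1\<close>;
      the floor of t / h would give \<open>K\<close> there.\<close>
    proof (cases "t = real K * h")
      case True
      with \<open>K \<noteq> 0\<close> \<open>0 < h\<close> show ?thesis
        by (intro that[of "K - 1"]) auto
    next
      case False
      define k where "k = nat \<lfloor>t / h\<rfloor>"
      have "real k \<le> t / h" "t / h < real k + 1"
        using True \<open>0 < h\<close> unfolding k_def by (auto simp: of_nat_nat)
      moreover have "t / h < real K"
        using True False \<open>0 < h\<close> by (simp add: pos_divide_less_eq)
      then have "k < K"
        using \<open>real k \<le> t / h\<close> by linarith
      ultimately show ?thesis
        using \<open>0 < h\<close> by (intro that[of k]) (auto simp: field_simps)
    qed
    then have "f t * indicator {0..real K * h} t
        = \<phi> k t * indicator {real k * h..real (Suc k) * h} t"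
      using True eq by simp
    also have "\<dots> \<le> (\<Sum>k<K. \<phi> k t * indicator {real k * h..real (Suc k) * h} t)"
      using k by (intro member_le_sum) auto
    finally show ?thesis .
  qed simp
  then have "(\<integral>\<^sup>+t\<in>{0..real K * h}. f t \<partial>lborel)
      \<le> (\<integral>\<^sup>+t. (\<Sum>k<K. \<phi> k t * indicator {real k * h..real (Suc k) * h} t) \<partial>lborel)"
    by (intro nn_integral_mono)
  also have "\<dots> = (\<Sum>k<K. \<integral>\<^sup>+t\<in>{real k * h..real (Suc k) * h}. \<phi> k t \<partial>lborel)"
    using meas by (intro nn_integral_sum) auto
  finally show ?thesis .
qed auto

section \<open>The bound on the time-averaged squared gradient\<close>

theorem theorem2:
  fixes F :: "real ^ 'd \<Rightarrow> real"
    and M :: "'w measure"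
    and x g :: "nat \<Rightarrow> 'w \<Rightarrow> real ^ 'd"
    and X :: "real \<Rightarrow> 'w \<Rightarrow> real ^ 'd"
    and x\<^sub>0 x_star :: "real ^ 'd"
    and L h p \<alpha> \<theta> C :: real
    and \<Psi>\<^sub>1 :: ereal
    and K :: nat
  assumes "prob_space M"
    and "L > 0" and "L_smooth L F"
    and "\<forall>y. F x_star \<le> F y"
    and "h > 0" and "K \<ge> 1"
    and "0 < p" and "p \<le> 1" and "\<alpha> \<ge> 0" and "\<theta> \<ge> 0"
    and "\<forall>\<omega>\<in>space M. x 0 \<omega> = x\<^sub>0"
    and "\<forall>k<K. \<forall>\<omega>\<in>space M. x (Suc k) \<omega> = x k \<omega> - h *\<^sub>R g k \<omega>"
    and "marina_estimator M F L p \<alpha> \<theta> K x g"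
    and "\<forall>k<K. \<forall>t\<in>{real k * h..real (Suc k) * h}. \<forall>\<omega>\<in>space M.
           X t \<omega> = x k \<omega> - (t - real k * h) *\<^sub>R g k \<omega>"
    and "h \<le> 1 / (10 * L) * sqrt (p / (1 + \<alpha>))"
    and "C = (8 * L\<^sup>2 * h\<^sup>2 + 2) / (1 - (1 - p) * (4 * L\<^sup>2 * h\<^sup>2 * \<alpha> + 1))"
    and "\<Psi>\<^sub>1 = ereal (F x\<^sub>0) + ereal (h * C) * enn2ereal (grad_mse M F x g 0)"
  shows "ereal (1 / (real K * h))
           * enn2ereal (\<integral>\<^sup>+t\<in>{0..real K * h}. E_norm2 M (\<lambda>\<omega>. grad F (X t \<omega>)) \<partial>lborel)
         \<le> 2 * (\<Psi>\<^sub>1 - ereal (F x_star)) / ereal (real K * h) + ereal (2 * C * \<theta>)"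
proof -
  note F = assms(3) and hpos = assms(5) and step = assms(12) and marina = assms(13)
  interpret prob_space M by fact
  have small: "100 * (L\<^sup>2 * h\<^sup>2 * (1 + \<alpha>)) \<le> p" and Lh: "L * h \<le> 1 / 2"
    using step_size_bound assms by blast+
  have C: "1 / p \<le> C"
    using marina_constant_ge small assms by blast
  then have Cpos: "0 < C"
    using \<open>0 < p\<close> by (smt (verit) divide_pos_pos)
  have Kh: "0 < real K * h"
    using \<open>K \<ge> 1\<close> hpos by simp
  have meas: "x k \<in> borel_measurable M" "g k \<in> borel_measurable M" if "k < K" for k
    using that marina by (auto simp: marina_estimator_def)
  define A where "A = (\<integral>\<^sup>+t\<in>{0..real K * h}. E_norm2 M (\<lambda>\<omega>. grad F (X t \<omega>)) \<partial>lborel)"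
  show ?thesis
  \<comment> \<open>If the initial error is infinite, so is \<open>\<Psi>\<^sub>1\<close>, because h
    C > 0, and the right-hand side is infinite.\<close>
  proof (cases "grad_mse M F x g 0 < \<infinity>")
    case False
    then have "\<Psi>\<^sub>1 = \<infinity>"
      using assms(17) hpos Cpos by (auto simp flip: less_top)
    then show ?thesis
      using Kh by simp
  next
    case True
    \<comment> \<open>With a finite initial error all errors and second moments are finite, so the
      absorption, which subtracts terms, can be done with real numbers.\<close>
    define \<gamma> where "\<gamma> k = enn2real (grad_mse M F x g k)" for k
    define \<tau> where "\<tau> k = enn2real (E_norm2 M (g k))" for k
    have fin: "grad_mse M F x g k = ennreal (\<gamma> k)" "E_norm2 M (g k) = ennreal (\<tau> k)" if "k < K" for k
      using marina_finite[OF \<open>prob_space M\<close> F hpos Lh assms(4,11) step marina True that]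
      by (simp_all add: \<gamma>_def \<tau>_def)
    have nonneg: "0 \<le> \<gamma> k" "0 \<le> \<tau> k" for k
      by (simp_all add: \<gamma>_def \<tau>_def)
    have "A \<le> (\<Sum>k<K. \<integral>\<^sup>+t\<in>{real k * h..real (Suc k) * h}.
        E_norm2 M (\<lambda>\<omega>. grad F (x k \<omega> - (t - real k * h) *\<^sub>R g k \<omega>)) \<partial>lborel)"
      unfolding A_def
    proof (rule nn_integral_piecewise_le[OF hpos])
      fix k assume "k < K"
      note meas[OF this, measurable] L_smooth_borel_measurable_grad[OF F, measurable]
      show "(\<lambda>t. E_norm2 M (\<lambda>\<omega>. grad F (x k \<omega> - (t - real k * h) *\<^sub>R g k \<omega>)))
          \<in> borel_measurable borel"
        unfolding E_norm2_def by measurable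
    next
      fix k t assume "k < K" "t \<in> {real k * h..real (Suc k) * h}"
      then show "E_norm2 M (\<lambda>\<omega>. grad F (X t \<omega>))
          = E_norm2 M (\<lambda>\<omega>. grad F (x k \<omega> - (t - real k * h) *\<^sub>R g k \<omega>))"
        unfolding E_norm2_def using assms(14) by (intro nn_integral_cong) simp
    qed
    then have "A + ennreal (h / 2) * (\<Sum>k<K. E_norm2 M (g k))
        \<le> ennreal (2 * (F x\<^sub>0 - F x_star)) + ennreal (2 * h) * (\<Sum>k<K. grad_mse M F x g k)"
      using expected_descent[OF \<open>prob_space M\<close> F less_imp_le[OF hpos] Lh assms(4,11) step meas]
      by (meson add_right_mono order_trans)
    also have "(\<Sum>k<K. E_norm2 M (g k)) = ennreal (\<Sum>k<K. \<tau> k)"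
      by (simp add: fin nonneg flip: sum_ennreal)
    also have "(\<Sum>k<K. grad_mse M F x g k) = ennreal (\<Sum>k<K. \<gamma> k)"
      by (simp add: fin nonneg flip: sum_ennreal)
    also have "ennreal (h / 2) * ennreal (\<Sum>k<K. \<tau> k) = ennreal (h / 2 * (\<Sum>k<K. \<tau> k))"
      using hpos nonneg by (intro ennreal_mult[symmetric] sum_nonneg) auto
    also have "ennreal (2 * h) * ennreal (\<Sum>k<K. \<gamma> k) = ennreal (2 * h * (\<Sum>k<K. \<gamma> k))"
      using hpos nonneg by (intro ennreal_mult[symmetric] sum_nonneg) auto
    also have "ennreal (2 * (F x\<^sub>0 - F x_star)) + ennreal (2 * h * (\<Sum>k<K. \<gamma> k))
        = ennreal (2 * (F x\<^sub>0 - F x_star) + 2 * h * (\<Sum>k<K. \<gamma> k))"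
      using hpos assms(4) nonneg by (intro ennreal_plus[symmetric] mult_nonneg_nonneg sum_nonneg) auto
    finally have A: "A + ennreal (h / 2 * (\<Sum>k<K. \<tau> k))
        \<le> ennreal (2 * (F x\<^sub>0 - F x_star) + 2 * h * (\<Sum>k<K. \<gamma> k))" .
    have "A < \<infinity>"
      by (rule le_less_trans[OF order_trans[OF _ A]]) auto
    then obtain a where a: "A = ennreal a" "0 \<le> a"
      by (cases A) auto
    have "0 \<le> 2 * (F x\<^sub>0 - F x_star) + 2 * h * (\<Sum>k<K. \<gamma> k)"
      using hpos assms(4) nonneg by (simp add: sum_nonneg)
    then have a_le: "a + h / 2 * (\<Sum>k<K. \<tau> k) \<le> 2 * (F x\<^sub>0 - F x_star) + 2 * h * (\<Sum>k<K. \<gamma> k)"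
      using A a hpos nonneg by (subst (asm) a(1), subst (asm) ennreal_plus[symmetric])
        (auto intro!: mult_nonneg_nonneg sum_nonneg simp: ennreal_le_iff)
    have rec: "\<gamma> (Suc k) \<le> (1 - p) * \<gamma> k + ((1 - p) * L\<^sup>2 * \<alpha> * h\<^sup>2) * \<tau> k + \<theta>" if "Suc k < K" for k
    proof -
      have "E_norm2 M (\<lambda>\<omega>. x (Suc k) \<omega> - x k \<omega>) = ennreal (h\<^sup>2) * E_norm2 M (g k)"
        using that step meas by (intro E_norm2_step) auto
      moreover have "grad_mse M F x g (Suc k) \<le> ennreal (1 - p) * grad_mse M F x g k
          + ennreal ((1 - p) * L\<^sup>2 * \<alpha>) * E_norm2 M (\<lambda>\<omega>. x (Suc k) \<omega> - x k \<omega>) + ennreal \<theta>"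
        using that marina unfolding marina_estimator_def by blast
      ultimately have "ennreal (\<gamma> (Suc k)) \<le> ennreal (1 - p) * ennreal (\<gamma> k)
          + ennreal ((1 - p) * L\<^sup>2 * \<alpha>) * (ennreal (h\<^sup>2) * ennreal (\<tau> k)) + ennreal \<theta>"
        using that by (simp add: fin)
      also have "\<dots> = ennreal ((1 - p) * \<gamma> k + ((1 - p) * L\<^sup>2 * \<alpha> * h\<^sup>2) * \<tau> k + \<theta>)"
        using assms nonneg[of k] by (simp add: ennreal_mult ennreal_plus mult.assoc)
      finally show ?thesis
        using assms nonneg[of k] by (subst (asm) ennreal_le_iff) auto
    qed
    have "p * (\<Sum>k<K. \<gamma> k)
        \<le> \<gamma> 0 + ((1 - p) * L\<^sup>2 * \<alpha> * h\<^sup>2) * (\<Sum>k<K. \<tau> k) + real K * \<theta>"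
      using assms nonneg by (intro sum_le_of_contraction rec) auto
    \<comment> \<open>The coefficient is at most L^2 h^2 (1 + \<alpha>), hence at most p / 100; the
      factor p cancels on division by p.\<close>
    also have "((1 - p) * L\<^sup>2 * \<alpha> * h\<^sup>2) * (\<Sum>k<K. \<tau> k) \<le> p / 100 * (\<Sum>k<K. \<tau> k)"
    proof (intro mult_right_mono sum_nonneg nonneg)
      have "(1 - p) * (L\<^sup>2 * h\<^sup>2 * \<alpha>) \<le> 1 * (L\<^sup>2 * h\<^sup>2 * (1 + \<alpha>))"
        using assms by (intro mult_mono) auto
      then show "(1 - p) * L\<^sup>2 * \<alpha> * h\<^sup>2 \<le> p / 100"
        using small by (simp add: ac_simps)
    qed
    finally have "(\<Sum>k<K. \<gamma> k) \<le> (\<gamma> 0 + real K * \<theta>) / p + (\<Sum>k<K. \<tau> k) / 100"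
      using \<open>0 < p\<close> by (simp add: field_simps)
    also have "(\<gamma> 0 + real K * \<theta>) / p \<le> C * (\<gamma> 0 + real K * \<theta>)"
      using mult_right_mono[OF C, of "\<gamma> 0 + real K * \<theta>"] nonneg \<open>\<theta> \<ge> 0\<close> by simp
    finally have "2 * h * (\<Sum>k<K. \<gamma> k)
        \<le> 2 * h * (C * (\<gamma> 0 + real K * \<theta>) + (\<Sum>k<K. \<tau> k) / 100)"
      using hpos by (intro mult_left_mono) auto
    moreover have "0 \<le> h * (\<Sum>k<K. \<tau> k)"
      using hpos nonneg by (simp add: sum_nonneg)
    \<comment> \<open>The second moments carry weight h / 50 on the right against h / 2 on the left,
      so they are absorbed. The initial error and \<theta> both enter with the factor 2 h C.\<close>
    ultimately have "a \<le> 2 * (F x\<^sub>0 + h * C * \<gamma> 0 - F x_star) + real K * h * (2 * C * \<theta>)"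
      using a_le by (simp add: algebra_simps)
    then have "a / (real K * h)
        \<le> (2 * (F x\<^sub>0 + h * C * \<gamma> 0 - F x_star) + real K * h * (2 * C * \<theta>)) / (real K * h)"
      using Kh by (intro divide_right_mono) auto
    then have "1 / (real K * h) * a
        \<le> 2 * (F x\<^sub>0 + h * C * \<gamma> 0 - F x_star) / (real K * h) + 2 * C * \<theta>"
      using hpos \<open>K \<ge> 1\<close> by (simp add: add_divide_distrib)
    moreover have "\<Psi>\<^sub>1 = ereal (F x\<^sub>0 + h * C * \<gamma> 0)"
      using assms(17) fin[of 0] \<open>K \<ge> 1\<close> nonneg by (simp add: enn2ereal_ennreal)
    moreover have "2 * (ereal u - ereal v) / ereal w + ereal z = ereal (2 * (u - v) / w + z)"
      if "0 < w" for u v w z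
      using that by simp
    ultimately show ?thesis
      unfolding A_def[symmetric] a(1)
      using Kh by (simp only: enn2ereal_ennreal[OF a(2)] times_ereal.simps ereal_less_eq)
  qed
qed

end
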